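(* Let $d_1,d_3,\alpha_2,\alpha_4>0$ and $\mu<0$ be real constants satisfying $$\alpha_2=24d_1,\quad d_3<1,\quad \mu<\frac{d_3}{2(d_3-1)},$$ $$(5-2\mu)d_3<\alpha_4<\frac{2}{10d_1-\mu}\left(\mu^2+2(24d_1d_3-d_3-29d_1)\mu-4d_1d_3\right).$$ Define $$\beta_1=\frac{2\alpha_2^2\left(\alpha_4+(2\mu-5)d_3\right)}{(10d_1-\mu+2\alpha_2)\alpha_4}+24d_1-\alpha_2,\quad \beta_3=\frac{2(2d_3-\mu)\alpha_2+(\beta_1-24d_1)\alpha_4}{\alpha_2},$$ $$\alpha_1=16d_1-4\mu+\beta_1,\quad \alpha_3=\frac{d_3\beta_1}{3d_1},\quad \kappa_1=\frac{5-2\mu}{\alpha_4},\quad \kappa_2=\frac{\beta_1(\alpha_2+\beta_1-24d_1)}{24d_1\alpha_2^2}.$$ Then $\alpha_1,\alpha_3,\beta_1,\beta_3,\kappa_1,\kappa_2$ are all positive. *)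

theory Defs
  imports Complex_Main
begin

end

theory Submission
  imports Defs
begin

text \<open>Setting \<open>\<alpha>2 = 24 * d1\<close> cancels \<open>24 * d1 - \<alpha>2\<close>,
  so \<open>\<beta>1\<close> is a positive multiple of
  \<open>\<alpha>4 - (5 - 2 * \<mu>) * d3\<close>, and its sign is the lower bound on
  \<open>\<alpha>4\<close>. Over the denominator \<open>58 * d1 - \<mu>\<close>, the numerator of
  \<open>\<beta>3\<close> is exactly the gap in the upper bound on \<open>\<alpha>4\<close>, once
  that bound is cleared of \<open>10 * d1 - \<mu>\<close>. The other four signs follow from
  \<open>\<beta>1 > 0\<close> and the signs of the parameters.\<close>

theorem mainTheorem7:
  fixes d1 d3 \<mu> \<alpha>1 \<alpha>2 \<alpha>3 \<alpha>4 \<beta>1 \<beta>3 \<kappa>1 \<kappa>2 :: real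
  assumes "d1 > 0" and "d3 > 0" and "\<alpha>2 > 0" and "\<alpha>4 > 0" and "\<mu> < 0"
    and "\<alpha>2 = 24 * d1"
    and "d3 < 1"
    and "\<mu> < d3 / (2 * (d3 - 1))"
    and "(5 - 2 * \<mu>) * d3 < \<alpha>4"
    and "\<alpha>4 < 2 / (10 * d1 - \<mu>) *
           (\<mu>^2 + 2 * (24 * d1 * d3 - d3 - 29 * d1) * \<mu> - 4 * d1 * d3)"
    and "\<beta>1 = 2 * \<alpha>2^2 * (\<alpha>4 + (2 * \<mu> - 5) * d3) / ((10 * d1 - \<mu> + 2 * \<alpha>2) * \<alpha>4)
           + 24 * d1 - \<alpha>2"
    and "\<beta>3 = (2 * (2 * d3 - \<mu>) * \<alpha>2 + (\<beta>1 - 24 * d1) * \<alpha>4) / \<alpha>2"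
    and "\<alpha>1 = 16 * d1 - 4 * \<mu> + \<beta>1"
    and "\<alpha>3 = d3 * \<beta>1 / (3 * d1)"
    and "\<kappa>1 = (5 - 2 * \<mu>) / \<alpha>4"
    and "\<kappa>2 = \<beta>1 * (\<alpha>2 + \<beta>1 - 24 * d1) / (24 * d1 * \<alpha>2^2)"
  shows "\<alpha>1 > 0 \<and> \<alpha>3 > 0 \<and> \<beta>1 > 0 \<and> \<beta>3 > 0 \<and> \<kappa>1 > 0 \<and> \<kappa>2 > 0"
proof -
  let ?g = "\<alpha>4 + (2 * \<mu> - 5) * d3"
  note d1 = \<open>d1 > 0\<close> and d3 = \<open>d3 > 0\<close> and \<alpha>4 = \<open>\<alpha>4 > 0\<close> and \<mu> = \<open>\<mu> < 0\<close>
    and \<alpha>2_eq = \<open>\<alpha>2 = 24 * d1\<close>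
  have g: "?g > 0"
    using \<open>(5 - 2 * \<mu>) * d3 < \<alpha>4\<close> by (simp add: algebra_simps)
  have p: "10 * d1 - \<mu> > 0" and q: "58 * d1 - \<mu> > 0"
    using d1 \<mu> by auto
  \<comment> \<open>Here \<open>2 * \<alpha>2^2 = 1152 * d1^2\<close> and
    \<open>10 * d1 - \<mu> + 2 * \<alpha>2 = 58 * d1 - \<mu>\<close>.\<close>
  have \<beta>1_eq: "\<beta>1 = 1152 * d1^2 * ?g / ((58 * d1 - \<mu>) * \<alpha>4)"
    using assms(11) unfolding \<alpha>2_eq by (simp add: power2_eq_square algebra_simps)
  have \<beta>1: "\<beta>1 > 0"
    unfolding \<beta>1_eq using d1 g q \<alpha>4 by (intro divide_pos_pos mult_pos_pos) auto
  have upper: "(10 * d1 - \<mu>) * \<alpha>4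
      < 2 * (\<mu>^2 + 2 * (24 * d1 * d3 - d3 - 29 * d1) * \<mu> - 4 * d1 * d3)"
    using assms(10) p by (simp add: field_simps)
  \<comment> \<open>The factor \<open>24 * d1\<close> is kept in front to cancel the denominator
    \<open>\<alpha>2\<close> of \<open>\<beta>3\<close>.\<close>
  have \<beta>1_\<alpha>4: "\<beta>1 * \<alpha>4 = 24 * d1 * (48 * d1 * ?g / (58 * d1 - \<mu>))"
    unfolding \<beta>1_eq using \<alpha>4 by (simp add: power2_eq_square)
  have "\<beta>3 = 2 * (2 * d3 - \<mu>) + \<beta>1 * \<alpha>4 / (24 * d1) - \<alpha>4"
    unfolding assms(12) \<alpha>2_eq using d1 by (simp add: field_simps)
  also have "\<dots> = 2 * (2 * d3 - \<mu>) + 48 * d1 * ?g / (58 * d1 - \<mu>) - \<alpha>4"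
    unfolding \<beta>1_\<alpha>4 using d1 by (subst nonzero_mult_div_cancel_left) auto
  \<comment> \<open>The coefficient of \<open>\<alpha>4\<close> becomes
    \<open>48 * d1 - (58 * d1 - \<mu>) = -(10 * d1 - \<mu>)\<close>, matching \<open>upper\<close>;
    the \<open>d1 * d3\<close> terms give \<open>232 - 240 = -8\<close>.\<close>
  also have "\<dots> = (2 * (\<mu>^2 + 2 * (24 * d1 * d3 - d3 - 29 * d1) * \<mu> - 4 * d1 * d3)
      - (10 * d1 - \<mu>) * \<alpha>4) / (58 * d1 - \<mu>)"
    using q by (simp add: field_simps power2_eq_square)
  also have "\<dots> > 0"
    using upper q by simp
  finally have \<beta>3: "\<beta>3 > 0" .
  \<comment> \<open>The factor \<open>\<alpha>2 + \<beta>1 - 24 * d1\<close> collapses to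
    \<open>\<beta>1\<close>, which leaves a square.\<close>
  have "\<kappa>2 = \<beta>1^2 / (24 * d1 * \<alpha>2^2)"
    unfolding assms(16) \<alpha>2_eq by (simp add: power2_eq_square)
  then have "\<kappa>2 > 0"
    using \<beta>1 d1 \<open>\<alpha>2 > 0\<close> by simp
  then show ?thesis
    using \<beta>1 \<beta>3 d1 d3 \<alpha>4 \<mu> assms(13-15) by simp
qed

end
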